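(* Let $f:R_1\rightarrow R_2$ be a homomorphism of commutative rings with identity, $J$ an ideal of $R_2$, $M_1$ an $R_1$-module, $M_2$ an $R_2$-module (regarded as an $R_1$-module via $f$), and $\varphi:M_1\rightarrow M_2$ an $R_1$-module homomorphism. Consider the $(R_1\Join^f J)$-module $M_1\Join^{\varphi}JM_2$ and let $N_1$ be a submodule of $M_1$. Then: (1) $N_1\Join^{\varphi}JM_2$ is a primary submodule of $M_1\Join^{\varphi}JM_2$ if and only if $N_1$ is a primary submodule of $M_1$. (2) $N_1\Join^{\varphi}JM_2$ is a weakly primary submodule of $M_1\Join^{\varphi}JM_2$ if and only if $N_1$ is a weakly primary submodule of $M_1$ and the following holds: for all $r_1\in R_1$, $m_1\in M_1$ with $r_1m_1=0$ but $r_1\notin\sqrt{(N_1:_{R_1}M_1)}$ and $m_1\notin N_1$, one has $f(r_1)m_2+j\varphi(m_1)+jm_2=0$ for every $j\in J$ and $m_2\in JM_2$.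
   Context: All modules are unital. $(N:_R M)=\{r\in R: rM\subseteq N\}$. $R_1\Join^f J=\{(r,f(r)+j): r\in R_1, j\in J\}$ is a subring of $R_1\times R_2$. $M_1\Join^{\varphi}JM_2=\{(m_1,\varphi(m_1)+m_2): m_1\in M_1, m_2\in JM_2\}$ is an $(R_1\Join^f J)$-module with $(r,f(r)+j)(m_1,\varphi(m_1)+m_2)=(rm_1,\varphi(rm_1)+f(r)m_2+j\varphi(m_1)+jm_2)$. $N_1\Join^{\varphi}JM_2=\{(m_1,\varphi(m_1)+m_2)\in M_1\Join^{\varphi}JM_2: m_1\in N_1\}$ is a submodule of it. A proper submodule $N$ of an $R$-module $M$ is primary (resp. weakly primary) if for all $a\in R$, $m\in M$, $am\in N$ (resp. $0\neq am\in N$) implies $a\in\sqrt{(N:_R M)}$ or $m\in N$. *)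

theory Defs
  imports "HOL-Algebra.Algebra"
begin

definition mod_hom ::
  "('a, 'r) ring_scheme \<Rightarrow> ('a, 'b, 'm) module_scheme \<Rightarrow> ('a, 'c, 'n) module_scheme \<Rightarrow> ('b \<Rightarrow> 'c) set"
  where "mod_hom R M N =
    {h \<in> carrier M \<rightarrow> carrier N.
       (\<forall>x\<in>carrier M. \<forall>y\<in>carrier M. h (x \<oplus>\<^bsub>M\<^esub> y) = h x \<oplus>\<^bsub>N\<^esub> h y) \<and>
       (\<forall>r\<in>carrier R. \<forall>x\<in>carrier M. h (r \<odot>\<^bsub>M\<^esub> x) = r \<odot>\<^bsub>N\<^esub> h x)}"

definition restrict_scalars :: "('a \<Rightarrow> 'b) \<Rightarrow> ('b, 'c, 'm) module_scheme \<Rightarrow> ('a, 'c) module"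
  where "restrict_scalars f M =
    ring.extend (ring.truncate M) (module.fields (\<lambda>r x. f r \<odot>\<^bsub>M\<^esub> x))"

definition colon :: "('a, 'r) ring_scheme \<Rightarrow> 'b set \<Rightarrow> ('a, 'b, 'm) module_scheme \<Rightarrow> 'a set"
  where "colon R N M = {r \<in> carrier R. (\<lambda>x. r \<odot>\<^bsub>M\<^esub> x) ` carrier M \<subseteq> N}"

definition radical :: "('a, 'r) ring_scheme \<Rightarrow> 'a set \<Rightarrow> 'a set"
  where "radical R I = {r \<in> carrier R. \<exists>n::nat. n > 0 \<and> r [^]\<^bsub>R\<^esub> n \<in> I}"

definition primary_submodule ::
  "'b set \<Rightarrow> ('a, 'r) ring_scheme \<Rightarrow> ('a, 'b, 'm) module_scheme \<Rightarrow> bool"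
  where "primary_submodule N R M \<longleftrightarrow>
    submodule N R M \<and> N \<noteq> carrier M \<and>
    (\<forall>a\<in>carrier R. \<forall>x\<in>carrier M.
       a \<odot>\<^bsub>M\<^esub> x \<in> N \<longrightarrow> a \<in> radical R (colon R N M) \<or> x \<in> N)"

definition weakly_primary_submodule ::
  "'b set \<Rightarrow> ('a, 'r) ring_scheme \<Rightarrow> ('a, 'b, 'm) module_scheme \<Rightarrow> bool"
  where "weakly_primary_submodule N R M \<longleftrightarrow>
    submodule N R M \<and> N \<noteq> carrier M \<and>
    (\<forall>a\<in>carrier R. \<forall>x\<in>carrier M.
       a \<odot>\<^bsub>M\<^esub> x \<noteq> \<zero>\<^bsub>M\<^esub> \<and> a \<odot>\<^bsub>M\<^esub> x \<in> N \<longrightarrow> a \<in> radical R (colon R N M) \<or> x \<in> N)"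

text \<open>\<open>J M\<close> is the submodule of all finite sums of products \<open>j x\<close>; the empty sum gives \<open>\<zero>\<close>.\<close>

definition ideal_smult :: "'a set \<Rightarrow> ('a, 'b, 'm) module_scheme \<Rightarrow> 'b set"
  where "ideal_smult J M =
    {(\<Oplus>\<^bsub>M\<^esub> i\<in>{..<n}. a i \<odot>\<^bsub>M\<^esub> x i) | (n::nat) a x.
       a \<in> {..<n} \<rightarrow> J \<and> x \<in> {..<n} \<rightarrow> carrier M}"

definition amalg_ring ::
  "('a, 'r) ring_scheme \<Rightarrow> ('b, 's) ring_scheme \<Rightarrow> ('a \<Rightarrow> 'b) \<Rightarrow> 'b set \<Rightarrow> ('a \<times> 'b) ring"
  where "amalg_ring R\<^sub>1 R\<^sub>2 f J =
    (RDirProd R\<^sub>1 R\<^sub>2)\<lparr>carrier := {(r, f r \<oplus>\<^bsub>R\<^sub>2\<^esub> j) | r j. r \<in> carrier R\<^sub>1 \<and> j \<in> J}\<rparr>"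

text \<open>The action of the amalgamated ring is componentwise. The lemma \<open>amalg_module_smult\<close> shows
  that it sends \<open>(r, f r + j)\<close> and \<open>(x, \<phi> x + y)\<close> to
  \<open>(r x, \<phi> (r x) + f r y + j \<phi> x + j y)\<close>. The \<open>mult\<close> and \<open>one\<close> fields of the record are
  irrelevant for modules.\<close>

definition amalg_module ::
  "('a, 'c, 'm) module_scheme \<Rightarrow> ('b, 'd, 'n) module_scheme \<Rightarrow> ('c \<Rightarrow> 'd) \<Rightarrow> 'b set
     \<Rightarrow> ('a \<times> 'b, 'c \<times> 'd) module"
  where "amalg_module M\<^sub>1 M\<^sub>2 \<phi> J =
    ring.extend
      ((RDirProd M\<^sub>1 M\<^sub>2)\<lparr>carrier :=
         {(x, \<phi> x \<oplus>\<^bsub>M\<^sub>2\<^esub> y) | x y. x \<in> carrier M\<^sub>1 \<and> y \<in> ideal_smult J M\<^sub>2}\<rparr>)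
      (module.fields (\<lambda>(r, s) (x, y). (r \<odot>\<^bsub>M\<^sub>1\<^esub> x, s \<odot>\<^bsub>M\<^sub>2\<^esub> y)))"

definition amalg_submodule ::
  "'c set \<Rightarrow> ('a, 'c, 'm) module_scheme \<Rightarrow> ('b, 'd, 'n) module_scheme \<Rightarrow> ('c \<Rightarrow> 'd) \<Rightarrow> 'b set
     \<Rightarrow> ('c \<times> 'd) set"
  where "amalg_submodule N\<^sub>1 M\<^sub>1 M\<^sub>2 \<phi> J = {p \<in> carrier (amalg_module M\<^sub>1 M\<^sub>2 \<phi> J). fst p \<in> N\<^sub>1}"

lemma restrict_scalars_simps:
  "carrier (restrict_scalars f M) = carrier M"
  "(\<oplus>\<^bsub>restrict_scalars f M\<^esub>) = (\<oplus>\<^bsub>M\<^esub>)"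
  "\<zero>\<^bsub>restrict_scalars f M\<^esub> = \<zero>\<^bsub>M\<^esub>"
  "(\<odot>\<^bsub>restrict_scalars f M\<^esub>) = (\<lambda>r x. f r \<odot>\<^bsub>M\<^esub> x)"
  by (simp_all add: restrict_scalars_def ring.defs module.defs)

lemma amalg_ring_simps:
  "carrier (amalg_ring R\<^sub>1 R\<^sub>2 f J) = {(r, f r \<oplus>\<^bsub>R\<^sub>2\<^esub> j) | r j. r \<in> carrier R\<^sub>1 \<and> j \<in> J}"
  "(\<oplus>\<^bsub>amalg_ring R\<^sub>1 R\<^sub>2 f J\<^esub>) = (\<lambda>(a, b) (c, d). (a \<oplus>\<^bsub>R\<^sub>1\<^esub> c, b \<oplus>\<^bsub>R\<^sub>2\<^esub> d))"
  "(\<otimes>\<^bsub>amalg_ring R\<^sub>1 R\<^sub>2 f J\<^esub>) = (\<lambda>(a, b) (c, d). (a \<otimes>\<^bsub>R\<^sub>1\<^esub> c, b \<otimes>\<^bsub>R\<^sub>2\<^esub> d))"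
  "\<zero>\<^bsub>amalg_ring R\<^sub>1 R\<^sub>2 f J\<^esub> = (\<zero>\<^bsub>R\<^sub>1\<^esub>, \<zero>\<^bsub>R\<^sub>2\<^esub>)"
  "\<one>\<^bsub>amalg_ring R\<^sub>1 R\<^sub>2 f J\<^esub> = (\<one>\<^bsub>R\<^sub>1\<^esub>, \<one>\<^bsub>R\<^sub>2\<^esub>)"
  by (simp_all add: amalg_ring_def RDirProd_def DirProd_def monoid.defs)

lemma amalg_module_simps:
  "carrier (amalg_module M\<^sub>1 M\<^sub>2 \<phi> J) =
     {(x, \<phi> x \<oplus>\<^bsub>M\<^sub>2\<^esub> y) | x y. x \<in> carrier M\<^sub>1 \<and> y \<in> ideal_smult J M\<^sub>2}"
  "(\<oplus>\<^bsub>amalg_module M\<^sub>1 M\<^sub>2 \<phi> J\<^esub>) = (\<lambda>(a, b) (c, d). (a \<oplus>\<^bsub>M\<^sub>1\<^esub> c, b \<oplus>\<^bsub>M\<^sub>2\<^esub> d))"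
  "\<zero>\<^bsub>amalg_module M\<^sub>1 M\<^sub>2 \<phi> J\<^esub> = (\<zero>\<^bsub>M\<^sub>1\<^esub>, \<zero>\<^bsub>M\<^sub>2\<^esub>)"
  "(\<odot>\<^bsub>amalg_module M\<^sub>1 M\<^sub>2 \<phi> J\<^esub>) = (\<lambda>(r, s) (x, y). (r \<odot>\<^bsub>M\<^sub>1\<^esub> x, s \<odot>\<^bsub>M\<^sub>2\<^esub> y))"
  by (simp_all add: amalg_module_def RDirProd_def DirProd_def monoid.defs ring.defs module.defs)

lemma restrict_scalars_module:
  assumes "cring R\<^sub>1" "f \<in> ring_hom R\<^sub>1 R\<^sub>2" "module R\<^sub>2 M"
  shows "module R\<^sub>1 (restrict_scalars f M)"
proof -
  interpret M: module R\<^sub>2 M by fact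
  have ag: "abelian_group (restrict_scalars f M)"
  proof (rule abelian_groupI)
    fix x assume "x \<in> carrier (restrict_scalars f M)"
    then show "\<exists>y\<in>carrier (restrict_scalars f M). y \<oplus>\<^bsub>restrict_scalars f M\<^esub> x = \<zero>\<^bsub>restrict_scalars f M\<^esub>"
      by (intro bexI[of _ "\<ominus>\<^bsub>M\<^esub> x"]) (auto simp: restrict_scalars_simps M.M.l_neg)
  qed (auto simp: restrict_scalars_simps M.M.a_assoc intro: M.M.a_comm)
  show ?thesis
    using assms(1,2) ag
    by (intro moduleI)
      (auto simp: restrict_scalars_simps M.smult_l_distr M.smult_r_distr M.smult_assoc1
        ring_hom_add ring_hom_mult ring_hom_one ring_hom_closed)
qed

lemma ideal_smult_submodule:
  assumes "module R M" "ideal J R"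
  shows "submodule (ideal_smult J M) R M"
proof -
  interpret module R M by fact
  interpret J: ideal J R by fact
  have sub: "ideal_smult J M \<subseteq> carrier M"
    by (auto simp: ideal_smult_def Pi_iff intro!: M.finsum_closed smult_closed J.Icarr)
  have sm: "c \<odot>\<^bsub>M\<^esub> u \<in> ideal_smult J M" if c: "c \<in> carrier R" and u: "u \<in> ideal_smult J M" for c u
  proof -
    from u obtain n :: nat and a x where
      ax: "a \<in> {..<n} \<rightarrow> J" "x \<in> {..<n} \<rightarrow> carrier M"
      and u: "u = (\<Oplus>\<^bsub>M\<^esub> i\<in>{..<n}. a i \<odot>\<^bsub>M\<^esub> x i)"
      unfolding ideal_smult_def by blast
    have "c \<odot>\<^bsub>M\<^esub> u = (\<Oplus>\<^bsub>M\<^esub> i\<in>{..<n}. c \<odot>\<^bsub>M\<^esub> (a i \<odot>\<^bsub>M\<^esub> x i))"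
      unfolding u using ax c by (intro finsum_smult_ldistr) (auto intro!: smult_closed J.Icarr)
    also have "\<dots> = (\<Oplus>\<^bsub>M\<^esub> i\<in>{..<n}. (c \<otimes>\<^bsub>R\<^esub> a i) \<odot>\<^bsub>M\<^esub> x i)"
      using ax c by (intro M.finsum_cong') (auto simp: smult_assoc1 J.Icarr Pi_iff)
    finally have eq: "c \<odot>\<^bsub>M\<^esub> u = (\<Oplus>\<^bsub>M\<^esub> i\<in>{..<n}. (c \<otimes>\<^bsub>R\<^esub> a i) \<odot>\<^bsub>M\<^esub> x i)" .
    have "(\<lambda>i. c \<otimes>\<^bsub>R\<^esub> a i) \<in> {..<n} \<rightarrow> J" using ax c J.I_l_closed by auto
    with eq ax(2) show ?thesis
      unfolding ideal_smult_def mem_Collect_eq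
      by (intro exI[of _ n] exI[of _ "\<lambda>i. c \<otimes>\<^bsub>R\<^esub> a i"] exI[of _ x]) blast
  qed
  have add: "u \<oplus>\<^bsub>M\<^esub> v \<in> ideal_smult J M"
    if u: "u \<in> ideal_smult J M" and v: "v \<in> ideal_smult J M" for u v
  proof -
    from u obtain n :: nat and a x where
      ax: "a \<in> {..<n} \<rightarrow> J" "x \<in> {..<n} \<rightarrow> carrier M"
      and u: "u = (\<Oplus>\<^bsub>M\<^esub> i\<in>{..<n}. a i \<odot>\<^bsub>M\<^esub> x i)"
      unfolding ideal_smult_def by blast
    from v obtain k :: nat and b y where
      bY: "b \<in> {..<k} \<rightarrow> J" "y \<in> {..<k} \<rightarrow> carrier M"
      and v: "v = (\<Oplus>\<^bsub>M\<^esub> i\<in>{..<k}. b i \<odot>\<^bsub>M\<^esub> y i)"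
      unfolding ideal_smult_def by blast
    define c where "c = (\<lambda>i. if i < n then a i else b (i - n))"
    define z where "z = (\<lambda>i. if i < n then x i else y (i - n))"
    have cz: "c \<in> {..<n + k} \<rightarrow> J" "z \<in> {..<n + k} \<rightarrow> carrier M"
      using ax bY by (auto simp: c_def z_def Pi_iff)
    have cl: "c i \<odot>\<^bsub>M\<^esub> z i \<in> carrier M" if "i < n + k" for i
      using that cz by (auto simp: Pi_iff intro!: smult_closed J.Icarr)
    have split: "{..<n + k} = {..<n} \<union> (\<lambda>i. n + i) ` {..<k}"
    proof (rule Set.set_eqI, rule iffI)
      fix i assume "i \<in> {..<n + k}"
      then show "i \<in> {..<n} \<union> (\<lambda>i. n + i) ` {..<k}"
        by (cases "i < n") (auto intro!: image_eqI[of _ _ "i - n"])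
    qed auto
    have "(\<Oplus>\<^bsub>M\<^esub> i\<in>{..<n + k}. c i \<odot>\<^bsub>M\<^esub> z i)
        = (\<Oplus>\<^bsub>M\<^esub> i\<in>{..<n}. c i \<odot>\<^bsub>M\<^esub> z i) \<oplus>\<^bsub>M\<^esub> (\<Oplus>\<^bsub>M\<^esub> i\<in>(\<lambda>i. n + i) ` {..<k}. c i \<odot>\<^bsub>M\<^esub> z i)"
      unfolding split using cl by (intro M.finsum_Un_disjoint) auto
    also have "(\<Oplus>\<^bsub>M\<^esub> i\<in>(\<lambda>i. n + i) ` {..<k}. c i \<odot>\<^bsub>M\<^esub> z i)
        = (\<Oplus>\<^bsub>M\<^esub> i\<in>{..<k}. c (n + i) \<odot>\<^bsub>M\<^esub> z (n + i))"
      using cl by (intro M.finsum_reindex) (auto simp: inj_on_def)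
    also have "\<dots> = v"
      unfolding v using bY
      by (intro M.finsum_cong') (auto simp: c_def z_def Pi_iff intro!: smult_closed J.Icarr)
    also have "(\<Oplus>\<^bsub>M\<^esub> i\<in>{..<n}. c i \<odot>\<^bsub>M\<^esub> z i) = u"
      unfolding u using ax
      by (intro M.finsum_cong') (auto simp: c_def z_def Pi_iff intro!: smult_closed J.Icarr)
    finally show ?thesis
      using cz unfolding ideal_smult_def by (metis (mono_tags, lifting) mem_Collect_eq)
  qed
  have zero: "\<zero>\<^bsub>M\<^esub> \<in> ideal_smult J M"
    unfolding ideal_smult_def mem_Collect_eq by (rule exI[of _ 0]) simp
  have neg: "\<ominus>\<^bsub>M\<^esub> u \<in> ideal_smult J M" if "u \<in> ideal_smult J M" for u
    using sm[of "\<ominus>\<^bsub>R\<^esub> \<one>\<^bsub>R\<^esub>" u] that sub by (auto simp: smult_l_minus subset_iff)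
  show ?thesis by (rule submoduleI[OF sub zero neg add sm])
qed

locale amalgamation =
  R1: cring R\<^sub>1 + R2: cring R\<^sub>2 + M1: module R\<^sub>1 M\<^sub>1 + M2: module R\<^sub>2 M\<^sub>2 + J: ideal J R\<^sub>2
  for R\<^sub>1 :: "('a, 'r) ring_scheme" and R\<^sub>2 :: "('b, 's) ring_scheme"
    and M\<^sub>1 :: "('a, 'c, 'm) module_scheme" and M\<^sub>2 :: "('b, 'd, 'n) module_scheme"
    and J and f and \<phi> +
  assumes f: "f \<in> ring_hom R\<^sub>1 R\<^sub>2"
    and \<phi>: "\<phi> \<in> mod_hom R\<^sub>1 M\<^sub>1 (restrict_scalars f M\<^sub>2)"
begin

lemmas f_simps = ring_hom_closed[OF f] ring_hom_add[OF f] ring_hom_mult[OF f] ring_hom_one[OF f]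

lemma phi_simps:
  "x \<in> carrier M\<^sub>1 \<Longrightarrow> \<phi> x \<in> carrier M\<^sub>2"
  "x \<in> carrier M\<^sub>1 \<Longrightarrow> y \<in> carrier M\<^sub>1 \<Longrightarrow> \<phi> (x \<oplus>\<^bsub>M\<^sub>1\<^esub> y) = \<phi> x \<oplus>\<^bsub>M\<^sub>2\<^esub> \<phi> y"
  "r \<in> carrier R\<^sub>1 \<Longrightarrow> x \<in> carrier M\<^sub>1 \<Longrightarrow> \<phi> (r \<odot>\<^bsub>M\<^sub>1\<^esub> x) = f r \<odot>\<^bsub>M\<^sub>2\<^esub> \<phi> x"
  using \<phi> by (auto simp: mod_hom_def restrict_scalars_simps)

lemma ideal_smult_carrier: "y \<in> ideal_smult J M\<^sub>2 \<Longrightarrow> y \<in> carrier M\<^sub>2"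
  using M2.submoduleE(1)[OF ideal_smult_submodule[OF M2.module_axioms J.ideal_axioms]] by auto

lemma amalg_module_smult:
  assumes "r \<in> carrier R\<^sub>1" "j \<in> J" "x \<in> carrier M\<^sub>1" "y \<in> ideal_smult J M\<^sub>2"
  shows "(r, f r \<oplus>\<^bsub>R\<^sub>2\<^esub> j) \<odot>\<^bsub>amalg_module M\<^sub>1 M\<^sub>2 \<phi> J\<^esub> (x, \<phi> x \<oplus>\<^bsub>M\<^sub>2\<^esub> y) =
    (r \<odot>\<^bsub>M\<^sub>1\<^esub> x, \<phi> (r \<odot>\<^bsub>M\<^sub>1\<^esub> x) \<oplus>\<^bsub>M\<^sub>2\<^esub> f r \<odot>\<^bsub>M\<^sub>2\<^esub> y \<oplus>\<^bsub>M\<^sub>2\<^esub> j \<odot>\<^bsub>M\<^sub>2\<^esub> \<phi> x \<oplus>\<^bsub>M\<^sub>2\<^esub> j \<odot>\<^bsub>M\<^sub>2\<^esub> y)"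
  using assms J.Icarr[of j] ideal_smult_carrier[of y] phi_simps f_simps
  by (simp add: amalg_module_simps M2.smult_l_distr M2.smult_r_distr M2.M.a_ac)

lemma f_zero_minus:
  "f \<zero>\<^bsub>R\<^sub>1\<^esub> = \<zero>\<^bsub>R\<^sub>2\<^esub>"
  "r \<in> carrier R\<^sub>1 \<Longrightarrow> f (\<ominus>\<^bsub>R\<^sub>1\<^esub> r) = \<ominus>\<^bsub>R\<^sub>2\<^esub> f r"
proof -
  interpret ring_hom_cring R\<^sub>1 R\<^sub>2 f
    by unfold_locales (rule f)
  show "f \<zero>\<^bsub>R\<^sub>1\<^esub> = \<zero>\<^bsub>R\<^sub>2\<^esub>" by simp
  show "r \<in> carrier R\<^sub>1 \<Longrightarrow> f (\<ominus>\<^bsub>R\<^sub>1\<^esub> r) = \<ominus>\<^bsub>R\<^sub>2\<^esub> f r" by simp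
qed

lemma phi_zero_minus:
  "\<phi> \<zero>\<^bsub>M\<^sub>1\<^esub> = \<zero>\<^bsub>M\<^sub>2\<^esub>"
  "x \<in> carrier M\<^sub>1 \<Longrightarrow> \<phi> (\<ominus>\<^bsub>M\<^sub>1\<^esub> x) = \<ominus>\<^bsub>M\<^sub>2\<^esub> \<phi> x"
proof -
  show "\<phi> \<zero>\<^bsub>M\<^sub>1\<^esub> = \<zero>\<^bsub>M\<^sub>2\<^esub>"
    using phi_simps(1)[of "\<zero>\<^bsub>M\<^sub>1\<^esub>"] phi_simps(3)[of "\<zero>\<^bsub>R\<^sub>1\<^esub>" "\<zero>\<^bsub>M\<^sub>1\<^esub>"]
    by (simp add: f_zero_minus)
  show "\<phi> (\<ominus>\<^bsub>M\<^sub>1\<^esub> x) = \<ominus>\<^bsub>M\<^sub>2\<^esub> \<phi> x" if "x \<in> carrier M\<^sub>1"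
    using that phi_simps(3)[of "\<ominus>\<^bsub>R\<^sub>1\<^esub> \<one>\<^bsub>R\<^sub>1\<^esub>" x]
    by (simp add: M1.smult_l_minus M2.smult_l_minus f_zero_minus f_simps phi_simps)
qed

lemmas JM2 = M2.submoduleE[OF ideal_smult_submodule[OF M2.module_axioms J.ideal_axioms]]

lemma zero_in_ideal_smult: "\<zero>\<^bsub>M\<^sub>2\<^esub> \<in> ideal_smult J M\<^sub>2"
proof -
  from JM2(2) obtain y where "y \<in> ideal_smult J M\<^sub>2" by blast
  with JM2(4)[of "\<zero>\<^bsub>R\<^sub>2\<^esub>" y] show ?thesis by (simp add: ideal_smult_carrier)
qed

lemma smult_in_ideal_smult:
  assumes "j \<in> J" "y \<in> carrier M\<^sub>2"
  shows "j \<odot>\<^bsub>M\<^sub>2\<^esub> y \<in> ideal_smult J M\<^sub>2"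
  unfolding ideal_smult_def mem_Collect_eq
  using assms J.Icarr[of j]
  by (intro exI[of _ 1] exI[of _ "\<lambda>_. j"] exI[of _ "\<lambda>_. y"]) (auto simp: lessThan_Suc)

lemma mem_amalg_ring_iff:
  "(r, s) \<in> carrier (amalg_ring R\<^sub>1 R\<^sub>2 f J) \<longleftrightarrow>
     r \<in> carrier R\<^sub>1 \<and> s \<in> carrier R\<^sub>2 \<and> s \<ominus>\<^bsub>R\<^sub>2\<^esub> f r \<in> J"
proof
  assume "(r, s) \<in> carrier (amalg_ring R\<^sub>1 R\<^sub>2 f J)"
  then obtain j where j: "r \<in> carrier R\<^sub>1" "j \<in> J" "s = f r \<oplus>\<^bsub>R\<^sub>2\<^esub> j"
    by (auto simp: amalg_ring_simps)
  moreover have "s \<ominus>\<^bsub>R\<^sub>2\<^esub> f r = j"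
    using j J.Icarr[of j] f_simps(1)[of r] by (simp add: R2.minus_eq R2.add.m_ac R2.r_neg R2.r_neg1 R2.r_neg2)
  ultimately show "r \<in> carrier R\<^sub>1 \<and> s \<in> carrier R\<^sub>2 \<and> s \<ominus>\<^bsub>R\<^sub>2\<^esub> f r \<in> J"
    using J.Icarr[of j] f_simps(1)[of r] by simp
next
  assume *: "r \<in> carrier R\<^sub>1 \<and> s \<in> carrier R\<^sub>2 \<and> s \<ominus>\<^bsub>R\<^sub>2\<^esub> f r \<in> J"
  then have "s = f r \<oplus>\<^bsub>R\<^sub>2\<^esub> (s \<ominus>\<^bsub>R\<^sub>2\<^esub> f r)"
    using f_simps(1)[of r] by (simp add: R2.minus_eq R2.add.m_lcomm R2.r_neg)
  with * show "(r, s) \<in> carrier (amalg_ring R\<^sub>1 R\<^sub>2 f J)"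
    by (auto simp: amalg_ring_simps)
qed

lemma mem_amalg_module_iff:
  "(x, y) \<in> carrier (amalg_module M\<^sub>1 M\<^sub>2 \<phi> J) \<longleftrightarrow>
     x \<in> carrier M\<^sub>1 \<and> y \<in> carrier M\<^sub>2 \<and> y \<ominus>\<^bsub>M\<^sub>2\<^esub> \<phi> x \<in> ideal_smult J M\<^sub>2"
proof
  assume "(x, y) \<in> carrier (amalg_module M\<^sub>1 M\<^sub>2 \<phi> J)"
  then obtain j where j: "x \<in> carrier M\<^sub>1" "j \<in> ideal_smult J M\<^sub>2" "y = \<phi> x \<oplus>\<^bsub>M\<^sub>2\<^esub> j"
    by (auto simp: amalg_module_simps)
  moreover have "y \<ominus>\<^bsub>M\<^sub>2\<^esub> \<phi> x = j"
    using j ideal_smult_carrier[of j] phi_simps(1)[of x]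
    by (simp add: M2.M.minus_eq M2.M.add.m_ac M2.M.r_neg M2.M.r_neg1 M2.M.r_neg2)
  ultimately show "x \<in> carrier M\<^sub>1 \<and> y \<in> carrier M\<^sub>2 \<and> y \<ominus>\<^bsub>M\<^sub>2\<^esub> \<phi> x \<in> ideal_smult J M\<^sub>2"
    using ideal_smult_carrier[of j] phi_simps(1)[of x] by simp
next
  assume *: "x \<in> carrier M\<^sub>1 \<and> y \<in> carrier M\<^sub>2 \<and> y \<ominus>\<^bsub>M\<^sub>2\<^esub> \<phi> x \<in> ideal_smult J M\<^sub>2"
  then have "y = \<phi> x \<oplus>\<^bsub>M\<^sub>2\<^esub> (y \<ominus>\<^bsub>M\<^sub>2\<^esub> \<phi> x)"
    using phi_simps(1)[of x] by (simp add: M2.M.minus_eq M2.M.add.m_lcomm M2.M.r_neg)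
  with * show "(x, y) \<in> carrier (amalg_module M\<^sub>1 M\<^sub>2 \<phi> J)"
    by (auto simp: amalg_module_simps)
qed

lemma amalg_ring_cring: "cring (amalg_ring R\<^sub>1 R\<^sub>2 f J)"
proof (rule cringI)
  let ?A = "amalg_ring R\<^sub>1 R\<^sub>2 f J"
  have add: "s \<oplus>\<^bsub>R\<^sub>2\<^esub> s' \<ominus>\<^bsub>R\<^sub>2\<^esub> f (r \<oplus>\<^bsub>R\<^sub>1\<^esub> r') \<in> J"
    if "(r, s) \<in> carrier ?A" "(r', s') \<in> carrier ?A" for r s r' s'
  proof -
    have "s \<oplus>\<^bsub>R\<^sub>2\<^esub> s' \<ominus>\<^bsub>R\<^sub>2\<^esub> f (r \<oplus>\<^bsub>R\<^sub>1\<^esub> r') = (s \<ominus>\<^bsub>R\<^sub>2\<^esub> f r) \<oplus>\<^bsub>R\<^sub>2\<^esub> (s' \<ominus>\<^bsub>R\<^sub>2\<^esub> f r')"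
      using that f_simps by (simp add: mem_amalg_ring_iff R2.minus_eq R2.minus_add R2.add.m_ac)
    then show ?thesis using that by (simp add: mem_amalg_ring_iff J.a_closed)
  qed
  have mult: "s \<otimes>\<^bsub>R\<^sub>2\<^esub> s' \<ominus>\<^bsub>R\<^sub>2\<^esub> f (r \<otimes>\<^bsub>R\<^sub>1\<^esub> r') \<in> J"
    if "(r, s) \<in> carrier ?A" "(r', s') \<in> carrier ?A" for r s r' s'
  proof -
    have "s \<otimes>\<^bsub>R\<^sub>2\<^esub> s' \<ominus>\<^bsub>R\<^sub>2\<^esub> f (r \<otimes>\<^bsub>R\<^sub>1\<^esub> r') =
        s \<otimes>\<^bsub>R\<^sub>2\<^esub> (s' \<ominus>\<^bsub>R\<^sub>2\<^esub> f r') \<oplus>\<^bsub>R\<^sub>2\<^esub> (s \<ominus>\<^bsub>R\<^sub>2\<^esub> f r) \<otimes>\<^bsub>R\<^sub>2\<^esub> f r'"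
      using that f_simps
      by (simp add: mem_amalg_ring_iff R2.minus_eq R2.r_distr R2.l_distr R2.l_minus R2.r_minus
          R2.add.m_assoc R2.r_neg1)
    then show ?thesis
      using that f_simps by (simp add: mem_amalg_ring_iff J.a_closed J.I_l_closed J.I_r_closed)
  qed
  have zero: "\<zero>\<^bsub>R\<^sub>2\<^esub> \<ominus>\<^bsub>R\<^sub>2\<^esub> f \<zero>\<^bsub>R\<^sub>1\<^esub> \<in> J" and one: "\<one>\<^bsub>R\<^sub>2\<^esub> \<ominus>\<^bsub>R\<^sub>2\<^esub> f \<one>\<^bsub>R\<^sub>1\<^esub> \<in> J"
    using J.zero_closed by (simp_all add: f_zero_minus f_simps R2.minus_eq R2.r_neg)
  show "abelian_group ?A"
  proof (rule abelian_groupI)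
    fix p assume "p \<in> carrier ?A"
    then obtain r s where p: "p = (r, s)" "(r, s) \<in> carrier ?A" by (cases p) auto
    have "\<ominus>\<^bsub>R\<^sub>2\<^esub> s \<ominus>\<^bsub>R\<^sub>2\<^esub> f (\<ominus>\<^bsub>R\<^sub>1\<^esub> r) = \<ominus>\<^bsub>R\<^sub>2\<^esub> (s \<ominus>\<^bsub>R\<^sub>2\<^esub> f r)"
      using p f_simps by (simp add: mem_amalg_ring_iff R2.minus_eq f_zero_minus R2.minus_add)
    then have "(\<ominus>\<^bsub>R\<^sub>1\<^esub> r, \<ominus>\<^bsub>R\<^sub>2\<^esub> s) \<in> carrier ?A"
      using p by (simp add: mem_amalg_ring_iff J.a_inv_closed)
    then show "\<exists>q\<in>carrier ?A. q \<oplus>\<^bsub>?A\<^esub> p = \<zero>\<^bsub>?A\<^esub>"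
      using p by (intro bexI[of _ "(\<ominus>\<^bsub>R\<^sub>1\<^esub> r, \<ominus>\<^bsub>R\<^sub>2\<^esub> s)"])
        (auto simp: amalg_ring_simps(2-) mem_amalg_ring_iff R1.l_neg R2.l_neg)
  qed (auto simp: amalg_ring_simps(2-) mem_amalg_ring_iff add zero R1.add.m_ac R2.add.m_ac)
  show "comm_monoid ?A"
    by (rule comm_monoidI)
      (auto simp: amalg_ring_simps(2-) mem_amalg_ring_iff mult one R1.m_ac R2.m_ac)
qed (auto simp: amalg_ring_simps(2-) mem_amalg_ring_iff R1.l_distr R2.l_distr)

lemma amalg_ring_subring: "subring (carrier (amalg_ring R\<^sub>1 R\<^sub>2 f J)) (RDirProd R\<^sub>1 R\<^sub>2)"
proof -
  interpret P: ring "RDirProd R\<^sub>1 R\<^sub>2" by (rule RDirProd_ring) unfold_locales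
  have "carrier (amalg_ring R\<^sub>1 R\<^sub>2 f J) \<subseteq> carrier (RDirProd R\<^sub>1 R\<^sub>2)"
    by (auto simp: mem_amalg_ring_iff RDirProd_carrier)
  moreover have "(RDirProd R\<^sub>1 R\<^sub>2)\<lparr>carrier := carrier (amalg_ring R\<^sub>1 R\<^sub>2 f J)\<rparr> = amalg_ring R\<^sub>1 R\<^sub>2 f J"
    by (simp add: amalg_ring_def)
  ultimately show ?thesis
    using P.subring_iff cring.axioms(1)[OF amalg_ring_cring] by metis
qed

lemma amalg_module_smult_closed:
  assumes "(r, s) \<in> carrier (amalg_ring R\<^sub>1 R\<^sub>2 f J)" "(x, y) \<in> carrier (amalg_module M\<^sub>1 M\<^sub>2 \<phi> J)"
  shows "s \<odot>\<^bsub>M\<^sub>2\<^esub> y \<ominus>\<^bsub>M\<^sub>2\<^esub> \<phi> (r \<odot>\<^bsub>M\<^sub>1\<^esub> x) \<in> ideal_smult J M\<^sub>2"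
proof -
  have "s \<odot>\<^bsub>M\<^sub>2\<^esub> y \<ominus>\<^bsub>M\<^sub>2\<^esub> \<phi> (r \<odot>\<^bsub>M\<^sub>1\<^esub> x) =
      s \<odot>\<^bsub>M\<^sub>2\<^esub> (y \<ominus>\<^bsub>M\<^sub>2\<^esub> \<phi> x) \<oplus>\<^bsub>M\<^sub>2\<^esub> (s \<ominus>\<^bsub>R\<^sub>2\<^esub> f r) \<odot>\<^bsub>M\<^sub>2\<^esub> \<phi> x"
    using assms f_simps phi_simps
    by (simp add: mem_amalg_ring_iff mem_amalg_module_iff R2.minus_eq M2.M.minus_eq M2.smult_r_distr
        M2.smult_l_distr M2.smult_l_minus M2.smult_r_minus M2.M.add.m_assoc M2.M.r_neg1)
  then show ?thesis
    using assms f_simps phi_simps JM2(4,5) smult_in_ideal_smult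
    by (simp add: mem_amalg_ring_iff mem_amalg_module_iff)
qed

lemma amalg_module_module: "module (amalg_ring R\<^sub>1 R\<^sub>2 f J) (amalg_module M\<^sub>1 M\<^sub>2 \<phi> J)"
proof (rule moduleI)
  let ?M = "amalg_module M\<^sub>1 M\<^sub>2 \<phi> J"
  show "cring (amalg_ring R\<^sub>1 R\<^sub>2 f J)" by (rule amalg_ring_cring)
  have add: "y \<oplus>\<^bsub>M\<^sub>2\<^esub> y' \<ominus>\<^bsub>M\<^sub>2\<^esub> \<phi> (x \<oplus>\<^bsub>M\<^sub>1\<^esub> x') \<in> ideal_smult J M\<^sub>2"
    if "(x, y) \<in> carrier ?M" "(x', y') \<in> carrier ?M" for x y x' y'
  proof -
    have "y \<oplus>\<^bsub>M\<^sub>2\<^esub> y' \<ominus>\<^bsub>M\<^sub>2\<^esub> \<phi> (x \<oplus>\<^bsub>M\<^sub>1\<^esub> x') = (y \<ominus>\<^bsub>M\<^sub>2\<^esub> \<phi> x) \<oplus>\<^bsub>M\<^sub>2\<^esub> (y' \<ominus>\<^bsub>M\<^sub>2\<^esub> \<phi> x')"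
      using that phi_simps
      by (simp add: mem_amalg_module_iff M2.M.minus_eq M2.M.minus_add M2.M.add.m_ac)
    then show ?thesis using that JM2(5) by (simp add: mem_amalg_module_iff)
  qed
  have zero: "\<zero>\<^bsub>M\<^sub>2\<^esub> \<ominus>\<^bsub>M\<^sub>2\<^esub> \<phi> \<zero>\<^bsub>M\<^sub>1\<^esub> \<in> ideal_smult J M\<^sub>2"
    by (simp add: phi_zero_minus M2.M.minus_eq M2.M.r_neg zero_in_ideal_smult)
  show "abelian_group ?M"
  proof (rule abelian_groupI)
    fix p assume "p \<in> carrier ?M"
    then obtain x y where p: "p = (x, y)" "(x, y) \<in> carrier ?M" by (cases p) auto
    have "\<ominus>\<^bsub>M\<^sub>2\<^esub> y \<ominus>\<^bsub>M\<^sub>2\<^esub> \<phi> (\<ominus>\<^bsub>M\<^sub>1\<^esub> x) = \<ominus>\<^bsub>M\<^sub>2\<^esub> (y \<ominus>\<^bsub>M\<^sub>2\<^esub> \<phi> x)"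
      using p phi_simps by (simp add: mem_amalg_module_iff M2.M.minus_eq phi_zero_minus M2.M.minus_add)
    then have "(\<ominus>\<^bsub>M\<^sub>1\<^esub> x, \<ominus>\<^bsub>M\<^sub>2\<^esub> y) \<in> carrier ?M"
      using p JM2(3) by (simp add: mem_amalg_module_iff)
    then show "\<exists>q\<in>carrier ?M. q \<oplus>\<^bsub>?M\<^esub> p = \<zero>\<^bsub>?M\<^esub>"
      using p by (intro bexI[of _ "(\<ominus>\<^bsub>M\<^sub>1\<^esub> x, \<ominus>\<^bsub>M\<^sub>2\<^esub> y)"])
        (auto simp: amalg_module_simps(2-) mem_amalg_module_iff M1.M.l_neg M2.M.l_neg)
  qed (auto simp: amalg_module_simps(2-) mem_amalg_module_iff add zero M1.M.add.m_ac M2.M.add.m_ac)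
qed (auto simp: amalg_ring_simps(2-) amalg_module_simps(2-) mem_amalg_ring_iff mem_amalg_module_iff
    amalg_module_smult_closed M1.smult_l_distr M2.smult_l_distr M1.smult_r_distr M2.smult_r_distr
    M1.smult_assoc1 M2.smult_assoc1)

lemma amalg_submodule_submodule:
  assumes "submodule N\<^sub>1 R\<^sub>1 M\<^sub>1"
  shows "submodule (amalg_submodule N\<^sub>1 M\<^sub>1 M\<^sub>2 \<phi> J) (amalg_ring R\<^sub>1 R\<^sub>2 f J)
    (amalg_module M\<^sub>1 M\<^sub>2 \<phi> J)"
proof -
  let ?R = "amalg_ring R\<^sub>1 R\<^sub>2 f J" and ?M = "amalg_module M\<^sub>1 M\<^sub>2 \<phi> J"
  interpret A: module ?R ?M by (rule amalg_module_module)
  note N = M1.submoduleE[OF assms]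
  have zero: "\<zero>\<^bsub>M\<^sub>1\<^esub> \<in> N\<^sub>1"
    using subgroup.one_closed[OF submodule.axioms(1)[OF assms]] by simp
  have smult: "a \<odot>\<^bsub>?M\<^esub> p \<in> amalg_submodule N\<^sub>1 M\<^sub>1 M\<^sub>2 \<phi> J"
    if "a \<in> carrier ?R" "p \<in> amalg_submodule N\<^sub>1 M\<^sub>1 M\<^sub>2 \<phi> J" for a p
    using that A.smult_closed[of a p] N(4)
    by (cases a; cases p) (auto simp: amalg_submodule_def amalg_module_simps(4) mem_amalg_ring_iff)
  have neg: "\<ominus>\<^bsub>?M\<^esub> p \<in> amalg_submodule N\<^sub>1 M\<^sub>1 M\<^sub>2 \<phi> J"
    if "p \<in> amalg_submodule N\<^sub>1 M\<^sub>1 M\<^sub>2 \<phi> J" for p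
  proof -
    have "p \<in> carrier ?M" using that by (simp add: amalg_submodule_def)
    then have "\<ominus>\<^bsub>?M\<^esub> p = (\<ominus>\<^bsub>?R\<^esub> \<one>\<^bsub>?R\<^esub>) \<odot>\<^bsub>?M\<^esub> p" by (simp add: A.smult_l_minus)
    then show ?thesis using smult that by simp
  qed
  have add: "p \<oplus>\<^bsub>?M\<^esub> q \<in> amalg_submodule N\<^sub>1 M\<^sub>1 M\<^sub>2 \<phi> J"
    if "p \<in> amalg_submodule N\<^sub>1 M\<^sub>1 M\<^sub>2 \<phi> J" "q \<in> amalg_submodule N\<^sub>1 M\<^sub>1 M\<^sub>2 \<phi> J" for p q
    using that A.M.a_closed[of p q] N(5)
    by (cases p; cases q) (auto simp: amalg_submodule_def amalg_module_simps(2))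
  have "\<zero>\<^bsub>?M\<^esub> \<in> amalg_submodule N\<^sub>1 M\<^sub>1 M\<^sub>2 \<phi> J"
    using A.M.zero_closed zero by (simp add: amalg_submodule_def amalg_module_simps(3))
  then show ?thesis
    by (intro A.submoduleI neg add smult) (auto simp: amalg_submodule_def)
qed

end

end

theory Submission
  imports Defs
begin

text \<open>The first projection identifies the data on the amalgamated module with that on \<open>M\<^sub>1\<close>:
  membership in the amalgamated submodule, in its residual and in the radical of the latter
  depends only on the first component, and every element of \<open>R\<^sub>1\<close> or \<open>M\<^sub>1\<close> is a first component.
  This gives the primary case. In the weakly primary case a product can vanish in the first
  component without vanishing in the second, and the extra condition excludes precisely this.\<close>

context amalgamation
begin

text \<open>Choosing \<open>j = 0\<close> gives each \<open>r\<close> a canonical lift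
  \<open>(r, f r)\<close>. Together with the analogous lifts \<open>(x, \<phi> x)\<close> of module
  elements, these serve as test elements whenever a statement about the amalgamation is pulled back
  to \<open>R\<^sub>1\<close> and \<open>M\<^sub>1\<close>.\<close>

lemma graph_mem_amalg_ring:
  assumes "r \<in> carrier R\<^sub>1"
  shows "(r, f r) \<in> carrier (amalg_ring R\<^sub>1 R\<^sub>2 f J)"
  using assms f_simps(1) J.zero_closed by (simp add: mem_amalg_ring_iff R2.minus_eq R2.r_neg)

lemma graph_mem_amalg_module:
  assumes "x \<in> carrier M\<^sub>1"
  shows "(x, \<phi> x) \<in> carrier (amalg_module M\<^sub>1 M\<^sub>2 \<phi> J)"
  using assms phi_simps(1) zero_in_ideal_smult
  by (simp add: mem_amalg_module_iff M2.M.minus_eq M2.M.r_neg)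

text \<open>Multiplication and unit are componentwise, hence so are powers. This brings the radical,
  which is defined through powers, within reach of the first projection.\<close>

lemma amalg_ring_nat_pow:
  fixes n :: nat
  shows "(r, s) [^]\<^bsub>amalg_ring R\<^sub>1 R\<^sub>2 f J\<^esub> n = (r [^]\<^bsub>R\<^sub>1\<^esub> n, s [^]\<^bsub>R\<^sub>2\<^esub> n)"
proof -
  interpret A: cring "amalg_ring R\<^sub>1 R\<^sub>2 f J" by (rule amalg_ring_cring)
  show ?thesis by (induction n) (simp_all add: amalg_ring_simps)
qed

lemma mem_amalg_submodule_iff:
  "(x, y) \<in> amalg_submodule N M\<^sub>1 M\<^sub>2 \<phi> J \<longleftrightarrow>
    (x, y) \<in> carrier (amalg_module M\<^sub>1 M\<^sub>2 \<phi> J) \<and> x \<in> N"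
  by (simp add: amalg_submodule_def)

text \<open>The action stays inside the amalgamated module, so the only condition left is the one on
  the first component; \<open>s\<close> and \<open>y\<close> do not affect it.\<close>

lemma smult_mem_amalg_submodule_iff:
  assumes "(r, s) \<in> carrier (amalg_ring R\<^sub>1 R\<^sub>2 f J)" "(x, y) \<in> carrier (amalg_module M\<^sub>1 M\<^sub>2 \<phi> J)"
  shows "(r, s) \<odot>\<^bsub>amalg_module M\<^sub>1 M\<^sub>2 \<phi> J\<^esub> (x, y) \<in> amalg_submodule N M\<^sub>1 M\<^sub>2 \<phi> J \<longleftrightarrow>
    r \<odot>\<^bsub>M\<^sub>1\<^esub> x \<in> N"
  using module.smult_closed[OF amalg_module_module assms]
  by (simp add: amalg_module_simps(4) mem_amalg_submodule_iff)

text \<open>This transfers properness. If the amalgamated submodule is everything, it contains every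
  graph point \<open>(x, \<phi> x)\<close>, which forces \<open>x\<close> into
  \<open>N\<close>.\<close>

lemma amalg_submodule_eq_carrier_iff:
  assumes "N \<subseteq> carrier M\<^sub>1"
  shows "amalg_submodule N M\<^sub>1 M\<^sub>2 \<phi> J = carrier (amalg_module M\<^sub>1 M\<^sub>2 \<phi> J) \<longleftrightarrow> N = carrier M\<^sub>1"
proof
  assume eq: "amalg_submodule N M\<^sub>1 M\<^sub>2 \<phi> J = carrier (amalg_module M\<^sub>1 M\<^sub>2 \<phi> J)"
  have "x \<in> N" if "x \<in> carrier M\<^sub>1" for x
    using graph_mem_amalg_module[OF that] mem_amalg_submodule_iff[of x "\<phi> x" N] by (simp add: eq)
  with assms show "N = carrier M\<^sub>1" by blast
next
  assume "N = carrier M\<^sub>1"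
  then show "amalg_submodule N M\<^sub>1 M\<^sub>2 \<phi> J = carrier (amalg_module M\<^sub>1 M\<^sub>2 \<phi> J)"
    by (auto simp: amalg_submodule_def mem_amalg_module_iff)
qed

text \<open>From left to right, \<open>(r, s)\<close> is tested on the graph points
  \<open>(x, \<phi> x)\<close>, whose first components exhaust \<open>M\<^sub>1\<close>. From right
  to left, the first component of every element of the amalgamated module lies in
  \<open>M\<^sub>1\<close>.\<close>

lemma mem_colon_amalg_iff:
  assumes "(r, s) \<in> carrier (amalg_ring R\<^sub>1 R\<^sub>2 f J)"
  shows "(r, s) \<in> colon (amalg_ring R\<^sub>1 R\<^sub>2 f J) (amalg_submodule N M\<^sub>1 M\<^sub>2 \<phi> J)
      (amalg_module M\<^sub>1 M\<^sub>2 \<phi> J) \<longleftrightarrow> r \<in> colon R\<^sub>1 N M\<^sub>1" (is "?L \<longleftrightarrow> ?R")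
proof
  assume L: ?L
  have "r \<odot>\<^bsub>M\<^sub>1\<^esub> x \<in> N" if "x \<in> carrier M\<^sub>1" for x
    using L graph_mem_amalg_module[OF that]
      smult_mem_amalg_submodule_iff[OF assms graph_mem_amalg_module[OF that]]
    by (auto simp: colon_def image_subset_iff)
  with assms show ?R by (auto simp: colon_def mem_amalg_ring_iff)
next
  assume R: ?R
  have "(r, s) \<odot>\<^bsub>amalg_module M\<^sub>1 M\<^sub>2 \<phi> J\<^esub> (x, y) \<in> amalg_submodule N M\<^sub>1 M\<^sub>2 \<phi> J"
    if "(x, y) \<in> carrier (amalg_module M\<^sub>1 M\<^sub>2 \<phi> J)" for x y
    using R that smult_mem_amalg_submodule_iff[OF assms that]
    by (auto simp: colon_def mem_amalg_module_iff)
  with assms show ?L by (auto simp: colon_def)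
qed

text \<open>Each power of \<open>(r, s)\<close> is again in the amalgamated ring and has first
  component \<open>r [^] n\<close>, so the description of the residual applies to it and the same
  exponent works on both sides.\<close>

lemma mem_radical_colon_amalg_iff:
  assumes "(r, s) \<in> carrier (amalg_ring R\<^sub>1 R\<^sub>2 f J)"
  shows "(r, s) \<in> radical (amalg_ring R\<^sub>1 R\<^sub>2 f J) (colon (amalg_ring R\<^sub>1 R\<^sub>2 f J)
      (amalg_submodule N M\<^sub>1 M\<^sub>2 \<phi> J) (amalg_module M\<^sub>1 M\<^sub>2 \<phi> J)) \<longleftrightarrow>
    r \<in> radical R\<^sub>1 (colon R\<^sub>1 N M\<^sub>1)"
proof -
  interpret A: cring "amalg_ring R\<^sub>1 R\<^sub>2 f J" by (rule amalg_ring_cring)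
  have "(r [^]\<^bsub>R\<^sub>1\<^esub> n, s [^]\<^bsub>R\<^sub>2\<^esub> n) \<in> carrier (amalg_ring R\<^sub>1 R\<^sub>2 f J)" for n :: nat
    using A.nat_pow_closed[OF assms, of n] by (simp add: amalg_ring_nat_pow)
  from mem_colon_amalg_iff[OF this] show ?thesis
    using assms by (auto simp: radical_def amalg_ring_nat_pow mem_amalg_ring_iff)
qed

text \<open>Once \<open>r x = 0\<close>, the summand \<open>\<phi> (r x)\<close> of the second
  component vanishes as well. What remains is exactly the expression in the extra condition of the
  weakly primary case.\<close>

lemma amalg_smult_eq_zero_iff:
  assumes "r \<in> carrier R\<^sub>1" "j \<in> J" "x \<in> carrier M\<^sub>1" "y \<in> ideal_smult J M\<^sub>2"
  shows "(r, f r \<oplus>\<^bsub>R\<^sub>2\<^esub> j) \<odot>\<^bsub>amalg_module M\<^sub>1 M\<^sub>2 \<phi> J\<^esub> (x, \<phi> x \<oplus>\<^bsub>M\<^sub>2\<^esub> y) =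
      \<zero>\<^bsub>amalg_module M\<^sub>1 M\<^sub>2 \<phi> J\<^esub> \<longleftrightarrow>
    r \<odot>\<^bsub>M\<^sub>1\<^esub> x = \<zero>\<^bsub>M\<^sub>1\<^esub> \<and> f r \<odot>\<^bsub>M\<^sub>2\<^esub> y \<oplus>\<^bsub>M\<^sub>2\<^esub> j \<odot>\<^bsub>M\<^sub>2\<^esub> \<phi> x \<oplus>\<^bsub>M\<^sub>2\<^esub> j \<odot>\<^bsub>M\<^sub>2\<^esub> y = \<zero>\<^bsub>M\<^sub>2\<^esub>"
  unfolding amalg_module_smult[OF assms] amalg_module_simps(3)
  using assms J.Icarr[of j] ideal_smult_carrier[of y] f_simps(1) phi_simps(1) phi_zero_minus(1)
  by auto

text \<open>Every ingredient of primariness is determined by first components. One direction lifts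
  \<open>r\<close> and \<open>x\<close> to graph elements, the other projects arbitrary
  pairs.\<close>

lemma primary_amalg_submodule_iff:
  assumes N: "submodule N R\<^sub>1 M\<^sub>1"
  shows "primary_submodule (amalg_submodule N M\<^sub>1 M\<^sub>2 \<phi> J)
      (amalg_ring R\<^sub>1 R\<^sub>2 f J) (amalg_module M\<^sub>1 M\<^sub>2 \<phi> J) \<longleftrightarrow>
    primary_submodule N R\<^sub>1 M\<^sub>1" (is "?L \<longleftrightarrow> ?R")
proof
  assume L: ?L
  have "r \<in> radical R\<^sub>1 (colon R\<^sub>1 N M\<^sub>1) \<or> x \<in> N"
    if r: "r \<in> carrier R\<^sub>1" and x: "x \<in> carrier M\<^sub>1" and rx: "r \<odot>\<^bsub>M\<^sub>1\<^esub> x \<in> N" for r x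
  proof -
    note p = graph_mem_amalg_ring[OF r] graph_mem_amalg_module[OF x]
    then show ?thesis
      using L rx smult_mem_amalg_submodule_iff[OF p, of N] mem_radical_colon_amalg_iff[OF p(1), of N]
        mem_amalg_submodule_iff[of x "\<phi> x" N]
      unfolding primary_submodule_def by blast
  qed
  with L N show ?R
    using amalg_submodule_eq_carrier_iff[OF M1.submoduleE(1)[OF N]]
    by (auto simp: primary_submodule_def)
next
  assume R: ?R
  have "(r, s) \<in> radical (amalg_ring R\<^sub>1 R\<^sub>2 f J) (colon (amalg_ring R\<^sub>1 R\<^sub>2 f J)
      (amalg_submodule N M\<^sub>1 M\<^sub>2 \<phi> J) (amalg_module M\<^sub>1 M\<^sub>2 \<phi> J)) \<or>
    (x, y) \<in> amalg_submodule N M\<^sub>1 M\<^sub>2 \<phi> J"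
    if p: "(r, s) \<in> carrier (amalg_ring R\<^sub>1 R\<^sub>2 f J)" "(x, y) \<in> carrier (amalg_module M\<^sub>1 M\<^sub>2 \<phi> J)"
      and rx: "(r, s) \<odot>\<^bsub>amalg_module M\<^sub>1 M\<^sub>2 \<phi> J\<^esub> (x, y) \<in> amalg_submodule N M\<^sub>1 M\<^sub>2 \<phi> J"
    for r s x y
  proof -
    have "r \<in> carrier R\<^sub>1" "x \<in> carrier M\<^sub>1" "r \<odot>\<^bsub>M\<^sub>1\<^esub> x \<in> N"
      using p rx smult_mem_amalg_submodule_iff[OF p]
      by (auto simp: mem_amalg_ring_iff mem_amalg_module_iff)
    with R have "r \<in> radical R\<^sub>1 (colon R\<^sub>1 N M\<^sub>1) \<or> x \<in> N" by (simp add: primary_submodule_def)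
    with p show ?thesis by (simp add: mem_radical_colon_amalg_iff mem_amalg_submodule_iff)
  qed
  with R show ?L
    using amalg_submodule_eq_carrier_iff[OF M1.submoduleE(1)[OF N]] amalg_submodule_submodule[OF N]
    by (auto simp: primary_submodule_def)
qed

text \<open>A product of pairs is nonzero in two ways: its first component is nonzero, which is
  governed by weak primariness of \<open>N\<close>, or only its second component is nonzero, which
  is governed by the extra condition.\<close>

lemma weakly_primary_amalg_submodule_iff:
  assumes N: "submodule N R\<^sub>1 M\<^sub>1"
  shows "weakly_primary_submodule (amalg_submodule N M\<^sub>1 M\<^sub>2 \<phi> J)
      (amalg_ring R\<^sub>1 R\<^sub>2 f J) (amalg_module M\<^sub>1 M\<^sub>2 \<phi> J) \<longleftrightarrow>
    weakly_primary_submodule N R\<^sub>1 M\<^sub>1 \<and>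
    (\<forall>r\<in>carrier R\<^sub>1. \<forall>x\<in>carrier M\<^sub>1.
      r \<odot>\<^bsub>M\<^sub>1\<^esub> x = \<zero>\<^bsub>M\<^sub>1\<^esub> \<and> r \<notin> radical R\<^sub>1 (colon R\<^sub>1 N M\<^sub>1) \<and> x \<notin> N \<longrightarrow>
      (\<forall>j\<in>J. \<forall>y\<in>ideal_smult J M\<^sub>2.
        f r \<odot>\<^bsub>M\<^sub>2\<^esub> y \<oplus>\<^bsub>M\<^sub>2\<^esub> j \<odot>\<^bsub>M\<^sub>2\<^esub> \<phi> x \<oplus>\<^bsub>M\<^sub>2\<^esub> j \<odot>\<^bsub>M\<^sub>2\<^esub> y = \<zero>\<^bsub>M\<^sub>2\<^esub>))"
    (is "?L \<longleftrightarrow> ?R \<and> ?C")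
proof
  assume L: ?L
  \<comment> \<open>Here \<open>s\<close> and \<open>y\<close> stay arbitrary because two different
    lifts are needed: graph elements to obtain weak primariness of \<open>N\<close>, and lifts with
    prescribed \<open>j\<close> and \<open>y\<close> to obtain the extra condition.\<close>
  have key: "r \<in> radical R\<^sub>1 (colon R\<^sub>1 N M\<^sub>1) \<or> x \<in> N"
    if p: "(r, s) \<in> carrier (amalg_ring R\<^sub>1 R\<^sub>2 f J)" "(x, y) \<in> carrier (amalg_module M\<^sub>1 M\<^sub>2 \<phi> J)"
      and "r \<odot>\<^bsub>M\<^sub>1\<^esub> x \<in> N"
      and "(r, s) \<odot>\<^bsub>amalg_module M\<^sub>1 M\<^sub>2 \<phi> J\<^esub> (x, y) \<noteq> \<zero>\<^bsub>amalg_module M\<^sub>1 M\<^sub>2 \<phi> J\<^esub>"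
    for r s x y
    using L that smult_mem_amalg_submodule_iff[OF p, of N] mem_radical_colon_amalg_iff[OF p(1), of N]
      mem_amalg_submodule_iff[of x y N]
    unfolding weakly_primary_submodule_def by blast
  have "r \<in> radical R\<^sub>1 (colon R\<^sub>1 N M\<^sub>1) \<or> x \<in> N"
    if "r \<in> carrier R\<^sub>1" "x \<in> carrier M\<^sub>1" "r \<odot>\<^bsub>M\<^sub>1\<^esub> x \<noteq> \<zero>\<^bsub>M\<^sub>1\<^esub>" "r \<odot>\<^bsub>M\<^sub>1\<^esub> x \<in> N" for r x
    using that
    \<comment> \<open>On graph lifts the product is nonzero already because its first component
      \<open>r x\<close> is.\<close>
    by (intro key[OF graph_mem_amalg_ring graph_mem_amalg_module])
      (simp_all add: amalg_module_simps(3,4))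
  with L N have ?R
    using amalg_submodule_eq_carrier_iff[OF M1.submoduleE(1)[OF N]]
    by (auto simp: weakly_primary_submodule_def)
  moreover have ?C
  proof (intro ballI impI, elim conjE, rule ccontr)
    fix r x j y
    assume r: "r \<in> carrier R\<^sub>1" and x: "x \<in> carrier M\<^sub>1" and j: "j \<in> J" and y: "y \<in> ideal_smult J M\<^sub>2"
      and rx: "r \<odot>\<^bsub>M\<^sub>1\<^esub> x = \<zero>\<^bsub>M\<^sub>1\<^esub>" and nr: "r \<notin> radical R\<^sub>1 (colon R\<^sub>1 N M\<^sub>1)" and nx: "x \<notin> N"
      and ne: "f r \<odot>\<^bsub>M\<^sub>2\<^esub> y \<oplus>\<^bsub>M\<^sub>2\<^esub> j \<odot>\<^bsub>M\<^sub>2\<^esub> \<phi> x \<oplus>\<^bsub>M\<^sub>2\<^esub> j \<odot>\<^bsub>M\<^sub>2\<^esub> y \<noteq> \<zero>\<^bsub>M\<^sub>2\<^esub>"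
    \<comment> \<open>If the expression were nonzero, these two lifts would have a nonzero product
      whose first component is \<open>0\<close>, hence in \<open>N\<close>; then \<open>key\<close>
      contradicts the choice of \<open>r\<close> and \<open>x\<close>.\<close>
    have "(r, f r \<oplus>\<^bsub>R\<^sub>2\<^esub> j) \<in> carrier (amalg_ring R\<^sub>1 R\<^sub>2 f J)"
      and "(x, \<phi> x \<oplus>\<^bsub>M\<^sub>2\<^esub> y) \<in> carrier (amalg_module M\<^sub>1 M\<^sub>2 \<phi> J)"
      using r x j y by (auto simp: amalg_ring_simps(1) amalg_module_simps(1))
    moreover have "r \<odot>\<^bsub>M\<^sub>1\<^esub> x \<in> N"
      using rx subgroup.one_closed[OF submodule.axioms(1)[OF N]] by simp
    ultimately show False
      using key ne nr nx amalg_smult_eq_zero_iff[OF r j x y] by blast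
  qed
  ultimately show "?R \<and> ?C" by blast
next
  assume RC: "?R \<and> ?C"
  have "a \<in> radical (amalg_ring R\<^sub>1 R\<^sub>2 f J) (colon (amalg_ring R\<^sub>1 R\<^sub>2 f J)
      (amalg_submodule N M\<^sub>1 M\<^sub>2 \<phi> J) (amalg_module M\<^sub>1 M\<^sub>2 \<phi> J)) \<or>
    p \<in> amalg_submodule N M\<^sub>1 M\<^sub>2 \<phi> J"
    if a: "a \<in> carrier (amalg_ring R\<^sub>1 R\<^sub>2 f J)" and p: "p \<in> carrier (amalg_module M\<^sub>1 M\<^sub>2 \<phi> J)"
      and ne: "a \<odot>\<^bsub>amalg_module M\<^sub>1 M\<^sub>2 \<phi> J\<^esub> p \<noteq> \<zero>\<^bsub>amalg_module M\<^sub>1 M\<^sub>2 \<phi> J\<^esub>"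
      and ap: "a \<odot>\<^bsub>amalg_module M\<^sub>1 M\<^sub>2 \<phi> J\<^esub> p \<in> amalg_submodule N M\<^sub>1 M\<^sub>2 \<phi> J"
    for a p
  proof -
    \<comment> \<open>The pairs are decomposed through \<open>j\<close> and \<open>y\<close>, since
      the extra condition is stated for these offsets from the graphs.\<close>
    obtain r j where rj: "r \<in> carrier R\<^sub>1" "j \<in> J" and a_eq: "a = (r, f r \<oplus>\<^bsub>R\<^sub>2\<^esub> j)"
      using a by (auto simp: amalg_ring_simps(1))
    obtain x y where xy: "x \<in> carrier M\<^sub>1" "y \<in> ideal_smult J M\<^sub>2" and p_eq: "p = (x, \<phi> x \<oplus>\<^bsub>M\<^sub>2\<^esub> y)"
      using p by (auto simp: amalg_module_simps(1))
    have "r \<odot>\<^bsub>M\<^sub>1\<^esub> x \<in> N"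
      using ap smult_mem_amalg_submodule_iff[OF a[unfolded a_eq] p[unfolded p_eq]]
      by (simp add: a_eq p_eq)
    \<comment> \<open>This yields the case split: if \<open>r x\<close> is nonzero, weak primariness
      of \<open>N\<close> applies; if \<open>r x = 0\<close>, the expression is nonzero and the
      contrapositive of the extra condition applies.\<close>
    moreover have "\<not> (r \<odot>\<^bsub>M\<^sub>1\<^esub> x = \<zero>\<^bsub>M\<^sub>1\<^esub> \<and>
        f r \<odot>\<^bsub>M\<^sub>2\<^esub> y \<oplus>\<^bsub>M\<^sub>2\<^esub> j \<odot>\<^bsub>M\<^sub>2\<^esub> \<phi> x \<oplus>\<^bsub>M\<^sub>2\<^esub> j \<odot>\<^bsub>M\<^sub>2\<^esub> y = \<zero>\<^bsub>M\<^sub>2\<^esub>)"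
      using ne amalg_smult_eq_zero_iff[OF rj xy] by (simp add: a_eq p_eq)
    ultimately have "r \<in> radical R\<^sub>1 (colon R\<^sub>1 N M\<^sub>1) \<or> x \<in> N"
      using RC rj xy unfolding weakly_primary_submodule_def by blast
    with a p show ?thesis
      by (simp add: a_eq p_eq mem_radical_colon_amalg_iff mem_amalg_submodule_iff)
  qed
  with RC show ?L
    using amalg_submodule_eq_carrier_iff[OF M1.submoduleE(1)[OF N]] amalg_submodule_submodule[OF N]
    by (auto simp: weakly_primary_submodule_def)
qed

end

theorem corollary4:
  fixes R\<^sub>1 :: "('a, 'r) ring_scheme" and R\<^sub>2 :: "('b, 's) ring_scheme"
    and M\<^sub>1 :: "('a, 'c, 'm) module_scheme" and M\<^sub>2 :: "('b, 'd, 'n) module_scheme"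
    and f :: "'a \<Rightarrow> 'b" and \<phi> :: "'c \<Rightarrow> 'd" and J :: "'b set" and N\<^sub>1 :: "'c set"
  assumes "cring R\<^sub>1" and "cring R\<^sub>2"
    and "f \<in> ring_hom R\<^sub>1 R\<^sub>2"
    and "ideal J R\<^sub>2"
    and "module R\<^sub>1 M\<^sub>1" and "module R\<^sub>2 M\<^sub>2"
    and "\<phi> \<in> mod_hom R\<^sub>1 M\<^sub>1 (restrict_scalars f M\<^sub>2)"
    and "submodule N\<^sub>1 R\<^sub>1 M\<^sub>1"
  shows "(primary_submodule (amalg_submodule N\<^sub>1 M\<^sub>1 M\<^sub>2 \<phi> J)
            (amalg_ring R\<^sub>1 R\<^sub>2 f J) (amalg_module M\<^sub>1 M\<^sub>2 \<phi> J) \<longleftrightarrow>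
          primary_submodule N\<^sub>1 R\<^sub>1 M\<^sub>1) \<and>
         (weakly_primary_submodule (amalg_submodule N\<^sub>1 M\<^sub>1 M\<^sub>2 \<phi> J)
            (amalg_ring R\<^sub>1 R\<^sub>2 f J) (amalg_module M\<^sub>1 M\<^sub>2 \<phi> J) \<longleftrightarrow>
          weakly_primary_submodule N\<^sub>1 R\<^sub>1 M\<^sub>1 \<and>
          (\<forall>r\<^sub>1\<in>carrier R\<^sub>1. \<forall>m\<^sub>1\<in>carrier M\<^sub>1.
             r\<^sub>1 \<odot>\<^bsub>M\<^sub>1\<^esub> m\<^sub>1 = \<zero>\<^bsub>M\<^sub>1\<^esub> \<and> r\<^sub>1 \<notin> radical R\<^sub>1 (colon R\<^sub>1 N\<^sub>1 M\<^sub>1) \<and> m\<^sub>1 \<notin> N\<^sub>1 \<longrightarrow>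
             (\<forall>j\<in>J. \<forall>m\<^sub>2\<in>ideal_smult J M\<^sub>2.
                f r\<^sub>1 \<odot>\<^bsub>M\<^sub>2\<^esub> m\<^sub>2 \<oplus>\<^bsub>M\<^sub>2\<^esub> j \<odot>\<^bsub>M\<^sub>2\<^esub> \<phi> m\<^sub>1 \<oplus>\<^bsub>M\<^sub>2\<^esub> j \<odot>\<^bsub>M\<^sub>2\<^esub> m\<^sub>2 = \<zero>\<^bsub>M\<^sub>2\<^esub>)))"
proof -
  interpret amalgamation R\<^sub>1 R\<^sub>2 M\<^sub>1 M\<^sub>2 J f \<phi>
    using assms by (intro amalgamation.intro amalgamation_axioms.intro)
  show ?thesis
    using primary_amalg_submodule_iff weakly_primary_amalg_submodule_iff assms(8) by blast
qed

end
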